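(* Let $G$ be a finite group, $k\geq 2$, $\mathbb{F}$ a field, and let $X_1,X_2,\dots,X_k$ be linear subspaces of the group algebra $\mathbb{F}[G]$ such that $X_1X_2\cdots X_k=0$. Put $t_i=\operatorname{codim}X_i$. Then any multiplicative $k$-matching in $G$ contains at most $\sum_{i=1}^k t_i$ $k$-tuples.
   Context: $X_1X_2\cdots X_k=0$ means that $u_1u_2\cdots u_k=0$ in $\mathbb{F}[G]$ for all $u_i\in X_i$. Codimensions are taken in $\mathbb{F}[G]$, so $t_i=|G|-\dim_{\mathbb{F}}X_i$. A multiplicative $k$-matching in $G$ is a set of ordered $k$-tuples $\{(x_a^{(1)},x_a^{(2)},\dots,x_a^{(k)}): a\in S\}\subset G^k$ (with $S$ an index set, distinct indices giving distinct tuples) such that for all $a_1,\dots,a_k\in S$ one has $x_{a_1}^{(1)}x_{a_2}^{(2)}\cdots x_{a_k}^{(k)}=1$ if and only if $a_1=a_2=\dots=a_k$. *)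

theory Defs
  imports Complex_Main "HOL-Algebra.Coset" "HOL-Algebra.Ring" "HOL-Library.Function_Algebras" "HOL-Library.FuncSet"
begin

definition list_product :: "('a, 'm) monoid_scheme \<Rightarrow> 'a list \<Rightarrow> 'a" where
  "list_product M xs = foldr (mult M) xs (one M)"

text \<open>
  Elements of the group algebra over a field \<open>'f\<close> are represented as coefficient functions that
  vanish outside the carrier of \<open>G\<close>, which gives the group algebra only for finite \<open>G\<close>.
  Multiplication is convolution; \<open>+\<close> and \<open>0\<close> are those of \<^theory>\<open>HOL-Library.Function_Algebras\<close>
  (whose pointwise product plays no role here).
\<close>

definition group_algebra :: "('a, 'm) monoid_scheme \<Rightarrow> ('a \<Rightarrow> 'f::field) ring" where
  "group_algebra G =
     \<lparr>carrier = {u. \<forall>x. x \<notin> carrier G \<longrightarrow> u x = 0},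
      mult = (\<lambda>u v z. \<Sum>(x, y) \<in> {(x, y). x \<in> carrier G \<and> y \<in> carrier G \<and> x \<otimes>\<^bsub>G\<^esub> y = z}. u x * v y),
      one = (\<lambda>x. if x = \<one>\<^bsub>G\<^esub> then 1 else 0),
      zero = 0,
      add = (+)\<rparr>"

lemma ring_group_algebra:
  assumes "group G" and fin: "finite (carrier G)"
  shows "ring (group_algebra G :: ('a \<Rightarrow> 'f::field) ring)"
proof -
  interpret group G by fact
  define A where "A = (group_algebra G :: ('a \<Rightarrow> 'f) ring)"
  define C where "C = carrier G"
  have finC: "finite C" using fin C_def by simp
  have car: "carrier A = {u. \<forall>x. x \<notin> C \<longrightarrow> u x = 0}"
    and one: "one A = (\<lambda>x. if x = \<one>\<^bsub>G\<^esub> then 1 else 0)"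
    and zero: "zero A = 0" and add: "add A = (+)"
    by (simp_all add: A_def group_algebra_def C_def)
  have mult: "mult A u v z = (\<Sum>x\<in>C. \<Sum>y\<in>C. if x \<otimes>\<^bsub>G\<^esub> y = z then u x * v y else 0)" for u v z
  proof -
    have "mult A u v z = (\<Sum>(x, y) \<in> {p \<in> C \<times> C. fst p \<otimes>\<^bsub>G\<^esub> snd p = z}. u x * v y)"
      by (auto simp: A_def group_algebra_def C_def intro!: sum.cong)
    also have "\<dots> = (\<Sum>p \<in> C \<times> C. if fst p \<otimes>\<^bsub>G\<^esub> snd p = z then (case p of (x, y) \<Rightarrow> u x * v y) else 0)"
      using finC by (subst sum.inter_filter) auto
    also have "\<dots> = (\<Sum>x\<in>C. \<Sum>y\<in>C. if x \<otimes>\<^bsub>G\<^esub> y = z then u x * v y else 0)"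
      by (simp add: sum.cartesian_product case_prod_unfold cong: if_cong)
    finally show ?thesis .
  qed
  have closed: "mult A u v \<in> carrier A" for u v
    unfolding car mem_Collect_eq mult by (auto simp: C_def intro!: sum.neutral)
  have assoc: "mult A (mult A u v) w = mult A u (mult A v w)" for u v w
  proof
    fix z
    have "mult A (mult A u v) w z =
      (\<Sum>t\<in>C. \<Sum>r\<in>C. \<Sum>x\<in>C. \<Sum>y\<in>C. if x \<otimes>\<^bsub>G\<^esub> y = t \<and> t \<otimes>\<^bsub>G\<^esub> r = z then u x * v y * w r else 0)"
      unfolding mult by (intro sum.cong) (auto simp: sum_distrib_right if_distrib intro!: sum.cong)
    also have "\<dots> = (\<Sum>r\<in>C. \<Sum>x\<in>C. \<Sum>y\<in>C. \<Sum>t\<in>C. if t = x \<otimes>\<^bsub>G\<^esub> y then (if t \<otimes>\<^bsub>G\<^esub> r = z then u x * v y * w r else 0) else 0)"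
      by (rule trans[OF sum.swap], rule sum.cong[OF refl], rule trans[OF sum.swap], rule sum.cong[OF refl], rule trans[OF sum.swap])
         (auto intro!: sum.cong)
    also have "\<dots> = (\<Sum>r\<in>C. \<Sum>x\<in>C. \<Sum>y\<in>C. if x \<otimes>\<^bsub>G\<^esub> y \<otimes>\<^bsub>G\<^esub> r = z then u x * v y * w r else 0)"
      using finC by (intro sum.cong) (auto simp: C_def)
    also have "\<dots> = (\<Sum>x\<in>C. \<Sum>y\<in>C. \<Sum>r\<in>C. if x \<otimes>\<^bsub>G\<^esub> (y \<otimes>\<^bsub>G\<^esub> r) = z then u x * v y * w r else 0)"
      by (rule trans[OF sum.swap], rule sum.cong[OF refl], rule trans[OF sum.swap]) (auto simp: C_def m_assoc intro!: sum.cong)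
    also have "\<dots> = (\<Sum>x\<in>C. \<Sum>y\<in>C. \<Sum>r\<in>C. \<Sum>t\<in>C. if t = y \<otimes>\<^bsub>G\<^esub> r then (if x \<otimes>\<^bsub>G\<^esub> t = z then u x * v y * w r else 0) else 0)"
      using finC by (intro sum.cong) (auto simp: C_def)
    also have "\<dots> = (\<Sum>x\<in>C. \<Sum>t\<in>C. \<Sum>y\<in>C. \<Sum>r\<in>C. if y \<otimes>\<^bsub>G\<^esub> r = t \<and> x \<otimes>\<^bsub>G\<^esub> t = z then u x * v y * w r else 0)"
      by (rule sum.cong[OF refl], rule trans[OF _ sum.swap], rule sum.cong[OF refl], rule trans[OF _ sum.swap]) (auto intro!: sum.cong)
   also have "\<dots> = mult A u (mult A v w) z"
      unfolding mult by (intro sum.cong) (auto simp: sum_distrib_left if_distrib mult.assoc intro!: sum.cong)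
    finally show "mult A (mult A u v) w z = mult A u (mult A v w) z" .
  qed
  have onel: "mult A (one A) u = u" if "u \<in> carrier A" for u
  proof
    fix z
    have "mult A (one A) u z = (\<Sum>x\<in>C. if x = \<one>\<^bsub>G\<^esub> then (\<Sum>y\<in>C. if y = z then u y else 0) else 0)"
      unfolding mult one by (intro sum.cong refl) (auto simp: C_def intro!: sum.cong sum.neutral)
    also have "\<dots> = u z" using finC that by (auto simp: C_def car)
    finally show "mult A (one A) u z = u z" .
  qed
  have oner: "mult A u (one A) = u" if "u \<in> carrier A" for u
  proof
    fix z
    have "mult A u (one A) z = (\<Sum>x\<in>C. \<Sum>y\<in>C. if y = \<one>\<^bsub>G\<^esub> then (if x = z then u x else 0) else 0)"
      unfolding mult one by (intro sum.cong refl) (auto simp: C_def)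
    also have "\<dots> = (\<Sum>x\<in>C. if x = z then u x else 0)"
      using finC by (intro sum.cong refl) (auto simp: C_def)
    also have "\<dots> = u z" using finC that by (auto simp: C_def car)
    finally show "mult A u (one A) z = u z" .
  qed
  have "ring A"
  proof (rule ringI)
    show "abelian_group A"
    proof (rule abelian_groupI)
      fix u assume "u \<in> carrier A"
      then show "\<exists>v\<in>carrier A. add A v u = zero A"
        by (intro bexI[of _ "- u"]) (auto simp: car add zero)
    qed (auto simp: car add zero ac_simps)
    show "monoid A"
      by (rule monoidI) (use closed assoc onel oner in \<open>auto simp: car one C_def\<close>)
    show "mult A (add A u v) w = add A (mult A u w) (mult A v w)" for u v w
      by (auto simp: mult add fun_eq_iff sum.distrib[symmetric] algebra_simps intro!: sum.cong)
    show "mult A w (add A u v) = add A (mult A w u) (mult A w v)" for u v w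
      by (auto simp: mult add fun_eq_iff sum.distrib[symmetric] algebra_simps intro!: sum.cong)
  qed
  then show ?thesis by (simp add: A_def)
qed

definition fun_scale :: "'f::field \<Rightarrow> ('a \<Rightarrow> 'f) \<Rightarrow> 'a \<Rightarrow> 'f" where
  "fun_scale c u = (\<lambda>x. c * u x)"

global_interpretation fun_space: vector_space "fun_scale :: 'f::field \<Rightarrow> ('a \<Rightarrow> 'f) \<Rightarrow> 'a \<Rightarrow> 'f"
  by unfold_locales (auto simp: fun_scale_def fun_eq_iff algebra_simps)

definition group_algebra_subspace ::
    "('a, 'm) monoid_scheme \<Rightarrow> ('a \<Rightarrow> 'f::field) set \<Rightarrow> bool" where
  "group_algebra_subspace G X \<longleftrightarrow> X \<subseteq> carrier (group_algebra G) \<and> fun_space.subspace X"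

text \<open>The subtraction does not truncate when \<open>G\<close> is finite and \<open>X\<close> is a subspace of the algebra.\<close>

definition codim :: "('a, 'm) monoid_scheme \<Rightarrow> ('a \<Rightarrow> 'f::field) set \<Rightarrow> nat" where
  "codim G X = order G - fun_space.dim X"

text \<open>
  A set of \<open>k\<close>-tuples is indexed by itself: \<open>a i\<close> is the tuple chosen for position \<open>i\<close>, and
  \<open>a i i\<close> is its \<open>i\<close>-th entry.
\<close>

definition multiplicative_matching ::
    "('a, 'm) monoid_scheme \<Rightarrow> nat \<Rightarrow> (nat \<Rightarrow> 'a) set \<Rightarrow> bool" where
  "multiplicative_matching G k T \<longleftrightarrow>
     T \<subseteq> ({1..k} \<rightarrow>\<^sub>E carrier G) \<and>
     (\<forall>a \<in> {1..k} \<rightarrow> T.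
        list_product G (map (\<lambda>i. a i i) [1..<Suc k]) = \<one>\<^bsub>G\<^esub> \<longleftrightarrow>
        (\<forall>i \<in> {1..k}. \<forall>j \<in> {1..k}. a i = a j))"

end

theory Submission imports Defs begin

text \<open>
  Evaluated on functions \<open>u\<^sub>i\<close> supported on the set \<open>A\<^sub>i\<close> of \<open>i\<close>-th entries of the matching, the
  coefficient of \<open>u\<^sub>1 \<dots> u\<^sub>k\<close> at the identity is the diagonal form
  \<open>\<Sum>\<^sub>a u\<^sub>1(a\<^sub>1) \<dots> u\<^sub>k(a\<^sub>k)\<close>, and the elements of \<open>X\<^sub>i\<close> supported on \<open>A\<^sub>i\<close> form a subspace of
  codimension at most \<open>t\<^sub>i\<close> in the functions on \<open>A\<^sub>i\<close>. If the matching had more than \<open>\<Sum> t\<^sub>i\<close> elements,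
  this form would not vanish: a subspace of codimension \<open>t\<close> contains a function that is nonzero
  outside at most \<open>t\<close> points, so fixing the first \<open>k - 2\<close> arguments suitably leaves a diagonal bilinear
  form of rank more than \<open>t\<^bsub>k-1\<^esub> + t\<^bsub>k\<^esub>\<close>, too large to vanish on the last two subspaces.
\<close>

section \<open>Interpolation by subspaces of functions\<close>

text \<open>For a subspace \<open>Y\<close> and finite \<open>P\<close>, this is linear independence
  of the evaluations at the points of \<open>P\<close>, as functionals on \<open>Y\<close>.
  Dimension bounds can thus be handled by counting points.\<close>

definition interpolates :: "('b \<Rightarrow> 'f) set \<Rightarrow> 'b set \<Rightarrow> bool" where
  "interpolates Y P \<longleftrightarrow> (\<forall>g. \<exists>y\<in>Y. \<forall>p\<in>P. y p = g p)"

lemma interpolatesE: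
  assumes "interpolates Y P"
  obtains y where "y \<in> Y" and "\<forall>p\<in>P. y p = g p"
  using assms[unfolded interpolates_def, rule_format, of g] that by blast

lemma interpolates_mono: "interpolates Y P \<Longrightarrow> Q \<subseteq> P \<Longrightarrow> interpolates Y Q"
  unfolding interpolates_def by (meson subsetD)

text \<open>A dual system for the evaluations at \<open>P\<close>, as in Lagrange interpolation.
  Values outside \<open>P\<close> remain uncontrolled.\<close>

lemma interpolates_cardinal_functions:
  assumes "interpolates Y P"
  obtains e :: "'b \<Rightarrow> 'b \<Rightarrow> 'f::field"
  where "\<And>p. e p \<in> Y" and "\<And>p q. q \<in> P \<Longrightarrow> e p q = (if q = p then 1 else 0)"
proof -
  have "\<exists>y\<in>Y. \<forall>q\<in>P. y q = (if q = p then 1 else 0)" for p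
    by (rule interpolatesE[OF assms, of "\<lambda>q. if q = p then 1 else 0"]) blast
  then show thesis using that by metis
qed

lemma sum_fun_scale_apply:
  fixes e :: "'c \<Rightarrow> 'b \<Rightarrow> 'f::field"
  shows "(\<Sum>p\<in>P. fun_scale (g p) (e p)) x = (\<Sum>p\<in>P. g p * e p x)"
  by (induction P rule: infinite_finite_induct) (auto simp: fun_scale_def)

text \<open>One linear condition costs at most one interpolation point: \<open>x\<close> itself if
  it lies in \<open>P\<close>, otherwise a point whose cardinal function is nonzero at
  \<open>x\<close>, or none if all cardinal functions vanish at \<open>x\<close>.\<close>

lemma interpolates_vanishing_at:
  fixes Y :: "('b \<Rightarrow> 'f::field) set"
  assumes Y: "fun_space.subspace Y" and P: "interpolates Y P" "finite P"
  shows "\<exists>Q \<subseteq> P - {x}. card P \<le> Suc (card Q) \<and> interpolates {y \<in> Y. y x = 0} Q"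
proof (cases "x \<in> P")
  case True
  have "interpolates {y \<in> Y. y x = 0} (P - {x})"
    unfolding interpolates_def
  proof
    fix g
    obtain y where "y \<in> Y" "\<forall>p\<in>P. y p = (g(x := 0)) p"
      by (rule interpolatesE[OF P(1)])
    with True show "\<exists>y\<in>{y \<in> Y. y x = 0}. \<forall>p\<in>P - {x}. y p = g p"
      by (intro bexI[of _ y]) auto
  qed
  with True P(2) show ?thesis by (intro exI[of _ "P - {x}"]) auto
next
  case False
  obtain e where e: "\<And>p. e p \<in> Y" "\<And>p q. q \<in> P \<Longrightarrow> e p q = (if q = p then 1 else 0)"
    using interpolates_cardinal_functions[OF P(1)] by blast
  show ?thesis
  proof (cases "\<exists>q\<in>P. e q x \<noteq> 0")
    case True
    then obtain q where q: "q \<in> P" "e q x \<noteq> 0" by blast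
    have "interpolates {y \<in> Y. y x = 0} (P - {q})"
      unfolding interpolates_def
    proof
      fix g
      obtain y where y: "y \<in> Y" "\<forall>p\<in>P. y p = g p"
        by (rule interpolatesE[OF P(1)])
      \<comment> \<open>The correction cancels the value at \<open>x\<close> and, within
        \<open>P\<close>, disturbs only the sacrificed point \<open>q\<close>.\<close>
      let ?y = "y - fun_scale (y x / e q x) (e q)"
      have "?y \<in> Y"
        using Y y(1) e(1) fun_space.subspace_diff fun_space.subspace_scale by blast
      moreover have "?y x = 0" using q(2) by (simp add: fun_scale_def)
      moreover have "\<forall>p\<in>P - {q}. ?y p = g p" using y(2) e(2) by (simp add: fun_scale_def)
      ultimately show "\<exists>y\<in>{y \<in> Y. y x = 0}. \<forall>p\<in>P - {q}. y p = g p" by blast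
    qed
    with q(1) P(2) False show ?thesis by (intro exI[of _ "P - {q}"]) (auto simp: card_Diff_singleton)
  next
    case zero: False
    have "interpolates {y \<in> Y. y x = 0} P"
      unfolding interpolates_def
    proof
      fix g :: "'b \<Rightarrow> 'f"
      \<comment> \<open>An arbitrary interpolant need not vanish at \<open>x\<close>, but this one
        does because every \<open>e p\<close> with \<open>p\<close> in \<open>P\<close>
        does.\<close>
      let ?y = "\<Sum>p\<in>P. fun_scale (g p) (e p)"
      have "?y \<in> Y"
        using Y e(1) by (intro fun_space.subspace_sum fun_space.subspace_scale) auto
      moreover have "?y x = 0"
        using zero unfolding sum_fun_scale_apply by (intro sum.neutral) auto
      moreover have "?y q = g q" if "q \<in> P" for q
        using that P(2) by (simp add: sum_fun_scale_apply e(2) if_distrib cong: if_cong)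
      ultimately show "\<exists>y\<in>{y \<in> Y. y x = 0}. \<forall>p\<in>P. y p = g p" by blast
    qed
    with False show ?thesis by (intro exI[of _ P]) auto
  qed
qed

lemma subspace_vanishing_on:
  assumes "fun_space.subspace Y"
  shows "fun_space.subspace {y \<in> Y. \<forall>x\<in>R. y x = 0}"
  using assms unfolding fun_space.subspace_def by (auto simp: fun_scale_def)

text \<open>The conditions at the points of \<open>R\<close> are imposed one after another, each
  costing at most one point of \<open>P\<close>.\<close>

lemma interpolates_vanishing_on:
  fixes Y :: "('b \<Rightarrow> 'f::field) set"
  assumes "finite R" and Y: "fun_space.subspace Y" and P: "interpolates Y P" "finite P"
  shows "\<exists>Q \<subseteq> P - R. card P \<le> card Q + card R \<and> interpolates {y \<in> Y. \<forall>x\<in>R. y x = 0} Q"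
  using assms(1)
proof (induction R)
  case empty
  show ?case using P by (intro exI[of _ P]) auto
next
  case (insert r R)
  then obtain Q where Q: "Q \<subseteq> P - R" "card P \<le> card Q + card R"
      "interpolates {y \<in> Y. \<forall>x\<in>R. y x = 0} Q"
    by blast
  have "finite Q" using Q(1) P(2) by (meson finite_Diff finite_subset)
  from interpolates_vanishing_at[OF subspace_vanishing_on[OF Y] Q(3) this, of r]
  obtain Q' where Q': "Q' \<subseteq> Q - {r}" "card Q \<le> Suc (card Q')"
      "interpolates {y \<in> {y \<in> Y. \<forall>x\<in>R. y x = 0}. y r = 0} Q'"
    by blast
  have "{y \<in> {y \<in> Y. \<forall>x\<in>R. y x = 0}. y r = 0} = {y \<in> Y. \<forall>x\<in>insert r R. y x = 0}" by auto
  with Q Q' insert.hyps show ?case by (intro exI[of _ Q']) auto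
qed

text \<open>For an interpolated set \<open>P\<close> of maximal size, the cardinal functions span
  \<open>Y\<close>: an element outside their span would leave a remainder that allows
  \<open>P\<close> to be enlarged.\<close>

lemma interpolates_dim:
  fixes Y :: "('b \<Rightarrow> 'f::field) set"
  assumes Y: "fun_space.subspace Y" and C: "finite C" and supp: "\<And>y x. y \<in> Y \<Longrightarrow> x \<notin> C \<Longrightarrow> y x = 0"
  shows "\<exists>P \<subseteq> C. fun_space.dim Y \<le> card P \<and> interpolates Y P"
proof -
  let ?F = "{P. P \<subseteq> C \<and> interpolates Y P}"
  have "finite ?F" using C by simp
  moreover have "{} \<in> ?F"
    using fun_space.subspace_0[OF Y] by (auto simp: interpolates_def)
  ultimately have fin: "finite (card ` ?F)" and ne: "card ` ?F \<noteq> {}" by auto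
  obtain P where P: "P \<subseteq> C" "interpolates Y P" and card_P: "card P = Max (card ` ?F)"
    using Max_in[OF fin ne] by auto
  have max: "card Q \<le> card P" if "Q \<subseteq> C" "interpolates Y Q" for Q
    unfolding card_P using fin that by (intro Max_ge) auto
  have finP: "finite P" using P(1) C finite_subset by blast
  obtain e where e: "\<And>p. e p \<in> Y" "\<And>p q. q \<in> P \<Longrightarrow> e p q = (if q = p then 1 else 0)"
    using interpolates_cardinal_functions[OF P(2)] by blast
  have "Y \<subseteq> fun_space.span (e ` P)"
  proof
    fix y assume y: "y \<in> Y"
    let ?s = "\<Sum>p\<in>P. fun_scale (y p) (e p)"
    have s_span: "?s \<in> fun_space.span (e ` P)"
      by (intro fun_space.span_sum fun_space.span_scale fun_space.span_base) auto
    have s_Y: "?s \<in> Y"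
      using Y e(1) by (intro fun_space.subspace_sum fun_space.subspace_scale) auto
    \<comment> \<open>The remainder after interpolating \<open>y\<close> on \<open>P\<close>, which
      therefore vanishes on \<open>P\<close>.\<close>
    define z where "z = y - ?s"
    have z: "z \<in> Y" unfolding z_def using Y y s_Y fun_space.subspace_diff by blast
    have zP: "z q = 0" if "q \<in> P" for q
      using that finP by (simp add: z_def sum_fun_scale_apply e(2) if_distrib cong: if_cong)
    have z0: "z x = 0" for x
    proof (rule ccontr)
      assume x: "z x \<noteq> 0"
      then have xC: "x \<in> C" and xP: "x \<notin> P" using supp[OF z] zP by auto
      have "interpolates Y (insert x P)"
        unfolding interpolates_def
      proof
        fix g
        obtain v where v: "v \<in> Y" "\<forall>p\<in>P. v p = g p"
          by (rule interpolatesE[OF P(2)])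
        \<comment> \<open>A multiple of \<open>z\<close> sets the value at \<open>x\<close> freely
          without changing anything on \<open>P\<close>, so \<open>insert x P\<close> contradicts
          maximality.\<close>
        let ?v = "v + fun_scale ((g x - v x) / z x) z"
        have "?v \<in> Y" using Y v(1) z fun_space.subspace_add fun_space.subspace_scale by blast
        moreover have "\<forall>p\<in>insert x P. ?v p = g p"
          using v(2) zP x by (simp add: fun_scale_def)
        ultimately show "\<exists>v\<in>Y. \<forall>p\<in>insert x P. v p = g p" by blast
      qed
      then have "card (insert x P) \<le> card P" using max xC P(1) by blast
      then show False using xP finP by simp
    qed
    have "y x = ?s x" for x using z0[of x] by (simp add: z_def)
    then have "y = ?s" by blast
    with s_span show "y \<in> fun_space.span (e ` P)" by simp
  qed
  then have "fun_space.dim Y \<le> card (e ` P)" using finP by (intro fun_space.dim_le_card) auto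
  also have "\<dots> \<le> card P" using finP by (rule card_image_le)
  finally show ?thesis using P by blast
qed

section \<open>Diagonal multilinear forms\<close>

text \<open>Each new factor can be chosen equal to 1 on \<open>P j\<close>, so it removes at most
  the \<open>t j\<close> points of \<open>S - P j\<close> from the support of the product.\<close>

lemma exists_product_with_large_support:
  fixes Y :: "'i \<Rightarrow> ('b \<Rightarrow> 'f::field) set"
  assumes "finite I" and S: "finite S"
    and P: "\<And>i. i \<in> I \<Longrightarrow> P i \<subseteq> S \<and> card S \<le> card (P i) + t i \<and> interpolates (Y i) (P i)"
  shows "\<exists>y. (\<forall>i\<in>I. y i \<in> Y i) \<and> card S \<le> card {a \<in> S. (\<Prod>i\<in>I. y i a) \<noteq> 0} + (\<Sum>i\<in>I. t i)"
  using assms(1,3)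
proof (induction I)
  case empty
  then show ?case by simp
next
  case (insert j I)
  have "\<exists>y. (\<forall>i\<in>I. y i \<in> Y i) \<and> card S \<le> card {a \<in> S. (\<Prod>i\<in>I. y i a) \<noteq> 0} + (\<Sum>i\<in>I. t i)"
    by (rule insert.IH) (use insert.prems in auto)
  then obtain y where y: "\<forall>i\<in>I. y i \<in> Y i"
      "card S \<le> card {a \<in> S. (\<Prod>i\<in>I. y i a) \<noteq> 0} + (\<Sum>i\<in>I. t i)"
    by blast
  have Pj: "P j \<subseteq> S" "card S \<le> card (P j) + t j" "interpolates (Y j) (P j)"
    using insert.prems by auto
  obtain v where v: "v \<in> Y j" "\<forall>p\<in>P j. v p = 1"
    by (rule interpolatesE[OF Pj(3)])
  define R where "R = {a \<in> S. (\<Prod>i\<in>I. y i a) \<noteq> 0}"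
  let ?y = "y(j := v)"
  have eq: "(\<Prod>i\<in>insert j I. ?y i a) = v a * (\<Prod>i\<in>I. y i a)" for a
  proof -
    have "(\<Prod>i\<in>I. ?y i a) = (\<Prod>i\<in>I. y i a)" using insert.hyps by (intro prod.cong) auto
    then show ?thesis using insert.hyps by simp
  qed
  have "R \<subseteq> {a \<in> S. (\<Prod>i\<in>insert j I. ?y i a) \<noteq> 0} \<union> (S - P j)"
    unfolding eq R_def using v(2) by auto
  then have "card R \<le> card ({a \<in> S. (\<Prod>i\<in>insert j I. ?y i a) \<noteq> 0} \<union> (S - P j))"
    using S by (intro card_mono) auto
  also have "\<dots> \<le> card {a \<in> S. (\<Prod>i\<in>insert j I. ?y i a) \<noteq> 0} + card (S - P j)"
    by (rule card_Un_le)
  also have "card (S - P j) \<le> t j"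
    using Pj S by (subst card_Diff_subset) (auto intro: finite_subset)
  finally have "card S \<le> card {a \<in> S. (\<Prod>i\<in>insert j I. ?y i a) \<noteq> 0} + (\<Sum>i\<in>insert j I. t i)"
    using y(2) insert.hyps unfolding R_def by simp
  moreover have "\<forall>i\<in>insert j I. ?y i \<in> Y i" using y(1) v(1) by simp
  ultimately show ?case by blast
qed

text \<open>The sum is reduced to a single nonzero term at a point \<open>p\<close> of the support
  of \<open>w\<close>: \<open>y\<close> removes the support points outside \<open>Q\<close>, and a
  cardinal function of \<open>Z\<close> at \<open>p\<close> removes the others in
  \<open>Q\<close>.\<close>

lemma diagonal_bilinear_form_nonzero:
  fixes Y Z :: "('b \<Rightarrow> 'f::field) set"
  assumes S: "finite S" and Y: "fun_space.subspace Y"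
    and P: "P \<subseteq> S" "card S \<le> card P + s" "interpolates Y P"
    and Q: "Q \<subseteq> S" "card S \<le> card Q + t" "interpolates Z Q"
    and w: "s + t < card {a \<in> S. w a \<noteq> 0}"
  shows "\<exists>y\<in>Y. \<exists>z\<in>Z. (\<Sum>a\<in>S. w a * y a * z a) \<noteq> 0"
proof -
  define R where "R = {a \<in> S. w a \<noteq> 0}"
  have fin: "finite P" "finite Q" "finite R" using S P(1) Q(1) finite_subset R_def by auto
  have "interpolates Y (P \<inter> R)" using P(3) interpolates_mono by blast
  \<comment> \<open>Elements of \<open>Z\<close> are controlled only on \<open>Q\<close>, so
    \<open>y\<close> has to vanish on the rest of \<open>R\<close>. Passing to
    \<open>P \<inter> R\<close> loses at most \<open>s\<close> points of \<open>R\<close> and this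
    condition at most \<open>t\<close> more, so \<open>P'\<close> is nonempty.\<close>
  from interpolates_vanishing_on[OF _ Y this, of "R - Q"] fin
  obtain P' where P': "P' \<subseteq> P \<inter> R - (R - Q)" "card (P \<inter> R) \<le> card P' + card (R - Q)"
      "interpolates {y \<in> Y. \<forall>x\<in>R - Q. y x = 0} P'"
    by blast
  have "card (R - Q) \<le> card (S - Q)" using S by (intro card_mono) (auto simp: R_def)
  also have "\<dots> \<le> t" using Q fin by (subst card_Diff_subset) auto
  finally have RQ: "card (R - Q) \<le> t" .
  have "card R \<le> card (P \<inter> R \<union> (S - P))" using S fin by (intro card_mono) (auto simp: R_def)
  also have "\<dots> \<le> card (P \<inter> R) + card (S - P)" by (rule card_Un_le)
  also have "card (S - P) \<le> s" using P fin by (subst card_Diff_subset) auto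
  finally have "card P' \<noteq> 0" using w P'(2) RQ unfolding R_def by linarith
  then obtain p where p: "p \<in> P'" by (metis card.empty equals0I)
  obtain y where y: "y \<in> Y" "\<forall>x\<in>R - Q. y x = 0" "y p = 1"
  proof (rule interpolatesE[OF P'(3)])
    fix y assume "y \<in> {y \<in> Y. \<forall>x\<in>R - Q. y x = 0}" "\<forall>q\<in>P'. y q = 1"
    with p show thesis by (intro that[of y]) auto
  qed
  obtain e where e: "\<And>p. e p \<in> Z" "\<And>p q. q \<in> Q \<Longrightarrow> e p q = (if q = p then 1 else 0)"
    using interpolates_cardinal_functions[OF Q(3)] by blast
  have pR: "p \<in> R" "p \<in> Q" using p P'(1) by auto
  \<comment> \<open>Outside \<open>R\<close> the factor \<open>w a\<close> is 0, on
    \<open>R - Q\<close> the factor \<open>y a\<close> is 0, and on \<open>Q\<close> the factor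
    \<open>e p a\<close> is 0 except at \<open>p\<close>.\<close>
  have "w a * y a * e p a = (if a = p then w p else 0)" if "a \<in> S" for a
    using that y pR e(2) unfolding R_def by (cases "a \<in> Q") auto
  then have "(\<Sum>a\<in>S. w a * y a * e p a) = w p"
    using S pR by (simp add: R_def cong: sum.cong)
  also have "w p \<noteq> 0" using pR by (simp add: R_def)
  finally show ?thesis using y(1) e(1)[of p] by blast
qed

text \<open>The product of the first \<open>k - 2\<close> functions serves as the weight of a
  bilinear form in the last two; its support is still larger than the sum of the last two
  bounds.\<close>

lemma diagonal_form_nonzero:
  fixes Y :: "nat \<Rightarrow> ('b \<Rightarrow> 'f::field) set"
  assumes S: "finite S" and k: "k \<ge> 2"
    and Y: "\<And>i. i \<in> {1..k} \<Longrightarrow> fun_space.subspace (Y i)"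
    and P: "\<And>i. i \<in> {1..k} \<Longrightarrow> P i \<subseteq> S \<and> card S \<le> card (P i) + t i \<and> interpolates (Y i) (P i)"
    and lt: "(\<Sum>i = 1..k. t i) < card S"
  shows "\<exists>u. (\<forall>i\<in>{1..k}. u i \<in> Y i) \<and> (\<Sum>a\<in>S. \<Prod>i = 1..k. u i a) \<noteq> 0"
proof -
  \<comment> \<open>\<open>m\<close> counts the arguments fixed in advance. For \<open>k = 2\<close>
    the weight is the empty product 1.\<close>
  obtain m where m: "k = Suc (Suc m)" using k by (metis add_2_eq_Suc le_Suc_ex)
  have "\<exists>y. (\<forall>i\<in>{1..m}. y i \<in> Y i) \<and>
      card S \<le> card {a \<in> S. (\<Prod>i = 1..m. y i a) \<noteq> 0} + (\<Sum>i = 1..m. t i)"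
    using S P m by (intro exists_product_with_large_support[where P = P]) auto
  then obtain y where y: "\<forall>i\<in>{1..m}. y i \<in> Y i"
      "card S \<le> card {a \<in> S. (\<Prod>i = 1..m. y i a) \<noteq> 0} + (\<Sum>i = 1..m. t i)"
    by blast
  have "t (Suc m) + t k < card {a \<in> S. (\<Prod>i = 1..m. y i a) \<noteq> 0}"
    using y(2) lt m by simp
  then have "\<exists>v\<in>Y (Suc m). \<exists>z\<in>Y k. (\<Sum>a\<in>S. (\<Prod>i = 1..m. y i a) * v a * z a) \<noteq> 0"
    using m P[of "Suc m"] P[of k] Y[of "Suc m"] S
    by (intro diagonal_bilinear_form_nonzero[where P = "P (Suc m)" and Q = "P k" and s = "t (Suc m)" and t = "t k"]) auto
  then obtain v z where vz: "v \<in> Y (Suc m)" "z \<in> Y k"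
      "(\<Sum>a\<in>S. (\<Prod>i = 1..m. y i a) * v a * z a) \<noteq> 0"
    by blast
  let ?u = "y(Suc m := v, k := z)"
  have "(\<Prod>i = 1..k. ?u i a) = (\<Prod>i = 1..m. y i a) * v a * z a" for a
  proof -
    have "(\<Prod>i = 1..m. ?u i a) = (\<Prod>i = 1..m. y i a)" using m by (intro prod.cong) auto
    then show ?thesis using m by simp
  qed
  then have "(\<Sum>a\<in>S. \<Prod>i = 1..k. ?u i a) \<noteq> 0" using vz(3) by simp
  moreover have "\<forall>i\<in>{1..k}. ?u i \<in> Y i"
    using y(1) vz(1,2) m by (auto simp: le_Suc_eq)
  ultimately show ?thesis by blast
qed

section \<open>Coefficients of products in the group algebra\<close>

lemma list_product_Cons: "list_product M (x # xs) = x \<otimes>\<^bsub>M\<^esub> list_product M xs"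
  by (simp add: list_product_def)

lemma (in monoid) list_product_closed:
  "set xs \<subseteq> carrier G \<Longrightarrow> list_product G xs \<in> carrier G"
  by (induction xs) (auto simp: list_product_def)

text \<open>Moving the condition on the product from the index set into the summand gives
  independent sums, which can be interchanged.\<close>

lemma group_algebra_mult_apply:
  assumes "finite (carrier G)"
  shows "(u \<otimes>\<^bsub>group_algebra G\<^esub> v) z =
    (\<Sum>x\<in>carrier G. \<Sum>y\<in>carrier G. if x \<otimes>\<^bsub>G\<^esub> y = z then u x * v y else 0)"
proof -
  have "(u \<otimes>\<^bsub>group_algebra G\<^esub> v) z =
      (\<Sum>(x, y) \<in> {p \<in> carrier G \<times> carrier G. fst p \<otimes>\<^bsub>G\<^esub> snd p = z}. u x * v y)"
    by (auto simp: group_algebra_def intro!: sum.cong)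
  also have "\<dots> = (\<Sum>p \<in> carrier G \<times> carrier G.
      if fst p \<otimes>\<^bsub>G\<^esub> snd p = z then (case p of (x, y) \<Rightarrow> u x * v y) else 0)"
    using assms by (subst sum.inter_filter) auto
  finally show ?thesis by (simp add: sum.cartesian_product case_prod_unfold cong: if_cong)
qed

lemma sum_PiE_insert:
  assumes "i \<notin> I"
  shows "sum h (insert i I \<rightarrow>\<^sub>E C) = (\<Sum>x\<in>C. \<Sum>f\<in>I \<rightarrow>\<^sub>E C. h (f(i := x)))"
proof -
  have "sum h (insert i I \<rightarrow>\<^sub>E C) = (\<Sum>(x, f)\<in>C \<times> (I \<rightarrow>\<^sub>E C). h (f(i := x)))"
    unfolding PiE_insert_eq
    by (subst sum.reindex) (use inj_combinator[OF assms, of "\<lambda>_. C"] in \<open>auto simp: case_prod_unfold\<close>)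
  then show ?thesis by (simp add: sum.cartesian_product)
qed

text \<open>Iterated convolution, by peeling off the first factor; the variable lower end
  \<open>m\<close> makes this an induction. Extensional functions ensure that each tuple is counted
  once.\<close>

lemma list_product_group_algebra_apply:
  fixes u :: "nat \<Rightarrow> 'a \<Rightarrow> 'f::field"
  assumes "monoid G" and fin: "finite (carrier G)" and "m \<le> n"
  shows "list_product (group_algebra G) (map u [m..<n]) z =
    (\<Sum>f\<in>{m..<n} \<rightarrow>\<^sub>E carrier G.
      if list_product G (map f [m..<n]) = z then \<Prod>i = m..<n. u i (f i) else 0)"
  using assms(3)
proof (induction m arbitrary: z rule: inc_induct)
  case base
  show ?case by (auto simp: list_product_def group_algebra_def)
next
  case (step m)
  interpret monoid G by fact
  let ?C = "carrier G" and ?F = "{Suc m..<n} \<rightarrow>\<^sub>E carrier G"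
  let ?p = "\<lambda>f. list_product G (map f [Suc m..<n])"
  have ins: "{m..<n} = insert m {Suc m..<n}" and upt: "[m..<n] = m # [Suc m..<n]"
    using step.hyps by (auto simp: upt_conv_Cons)
  have finF: "finite ?F" using fin by (intro finite_PiE) auto
  have pC: "?p f \<in> ?C" if "f \<in> ?F" for f
    using that by (intro list_product_closed) auto
  have "list_product (group_algebra G) (map u [m..<n]) z =
      (\<Sum>x\<in>?C. \<Sum>y\<in>?C. if x \<otimes>\<^bsub>G\<^esub> y = z then u m x *
        (\<Sum>f\<in>?F. if ?p f = y then \<Prod>i = Suc m..<n. u i (f i) else 0) else 0)"
    unfolding upt list.map list_product_Cons group_algebra_mult_apply[OF fin] step.IH ..
  \<comment> \<open>The intermediate product \<open>y\<close> is determined by \<open>f\<close>, so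
    its sum will collapse once moved innermost.\<close>
  also have "\<dots> = (\<Sum>x\<in>?C. \<Sum>y\<in>?C. \<Sum>f\<in>?F. if y = ?p f then
      (if x \<otimes>\<^bsub>G\<^esub> ?p f = z then u m x * (\<Prod>i = Suc m..<n. u i (f i)) else 0) else 0)"
    by (intro sum.cong refl) (auto simp: sum_distrib_left intro!: sum.cong sum.neutral)
  also have "\<dots> = (\<Sum>x\<in>?C. \<Sum>f\<in>?F. \<Sum>y\<in>?C. if y = ?p f then
      (if x \<otimes>\<^bsub>G\<^esub> ?p f = z then u m x * (\<Prod>i = Suc m..<n. u i (f i)) else 0) else 0)"
    by (rule sum.cong[OF refl], rule sum.swap)
  also have "\<dots> = (\<Sum>x\<in>?C. \<Sum>f\<in>?F.
      if x \<otimes>\<^bsub>G\<^esub> ?p f = z then u m x * (\<Prod>i = Suc m..<n. u i (f i)) else 0)"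
    using fin pC by (intro sum.cong refl) simp
  also have "\<dots> = (\<Sum>x\<in>?C. \<Sum>f\<in>?F. if list_product G (map (f(m := x)) [m..<n]) = z
      then \<Prod>i = m..<n. u i ((f(m := x)) i) else 0)"
  proof (intro sum.cong refl)
    fix x :: 'a and f :: "nat \<Rightarrow> 'a"
    have "map (f(m := x)) [m..<n] = x # map f [Suc m..<n]" unfolding upt by auto
    moreover have "(\<Prod>i = m..<n. u i ((f(m := x)) i)) = u m x * (\<Prod>i = Suc m..<n. u i (f i))"
      unfolding ins by (subst prod.insert) (auto intro!: prod.cong)
    ultimately show "(if x \<otimes>\<^bsub>G\<^esub> ?p f = z then u m x * (\<Prod>i = Suc m..<n. u i (f i)) else 0) =
        (if list_product G (map (f(m := x)) [m..<n]) = z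
         then \<Prod>i = m..<n. u i ((f(m := x)) i) else 0)"
      by (simp add: list_product_Cons)
  qed
  also have "\<dots> = (\<Sum>f\<in>{m..<n} \<rightarrow>\<^sub>E ?C. if list_product G (map f [m..<n]) = z
      then \<Prod>i = m..<n. u i (f i) else 0)"
    unfolding ins by (subst sum_PiE_insert) auto
  finally show ?case .
qed

section \<open>Multiplicative matchings\<close>

lemma multiplicative_matching_product:
  assumes "multiplicative_matching G k T" and "a \<in> T"
  shows "list_product G (map a [1..<Suc k]) = \<one>\<^bsub>G\<^esub>"
  using assms unfolding multiplicative_matching_def
  by (auto dest!: bspec[of _ _ "\<lambda>_. a"])

lemma multiplicative_matching_product_oneD:
  assumes "multiplicative_matching G k T" and "\<And>i. i \<in> {1..k} \<Longrightarrow> a i \<in> T"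
    and "list_product G (map (\<lambda>i. a i i) [1..<Suc k]) = \<one>\<^bsub>G\<^esub>"
    and "i \<in> {1..k}" "j \<in> {1..k}"
  shows "a i = a j"
  using assms unfolding multiplicative_matching_def Pi_def by blast

text \<open>If \<open>a\<close> and \<open>b\<close> agree at position \<open>i\<close>, taking
  \<open>b\<close> there and \<open>a\<close> elsewhere still gives product 1, so the matching
  property forces \<open>a = b\<close>. A second position exists because
  \<open>k \<ge> 2\<close>.\<close>

lemma multiplicative_matching_inj_on:
  assumes M: "multiplicative_matching G k T" and k: "k \<ge> 2" and i: "i \<in> {1..k}"
  shows "inj_on (\<lambda>a. a i) T"
proof (rule inj_onI)
  fix a b assume ab: "a \<in> T" "b \<in> T" "a i = b i"
  let ?c = "\<lambda>j. if j = i then b else a"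
  have "(\<lambda>j. ?c j j) = a" using ab(3) by auto
  then have one: "list_product G (map (\<lambda>j. ?c j j) [1..<Suc k]) = \<one>\<^bsub>G\<^esub>"
    using multiplicative_matching_product[OF M ab(1)] by simp
  obtain j where j: "j \<in> {1..k}" "j \<noteq> i"
  proof (cases "i = 1")
    case True
    then show thesis using that[of 2] k by auto
  next
    case False
    then show thesis using that[of 1] k by auto
  qed
  have "?c j = ?c i"
    by (rule multiplicative_matching_product_oneD[where a = ?c, OF M _ one j(1) i]) (use ab in auto)
  then show "a = b" using j(2) by simp
qed

text \<open>The supports leave only tuples whose entries all come from members of \<open>T\<close>.
  Among these, product 1 forces a common member, so exactly the tuples in \<open>T\<close>
  remain.\<close>

lemma coefficient_at_one_on_matching:
  fixes u :: "nat \<Rightarrow> 'a \<Rightarrow> 'f::field"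
  assumes "monoid G" and fin: "finite (carrier G)" and k: "k \<ge> 1"
    and M: "multiplicative_matching G k T"
    and supp: "\<And>i x. i \<in> {1..k} \<Longrightarrow> x \<notin> (\<lambda>a. a i) ` T \<Longrightarrow> u i x = 0"
  shows "list_product (group_algebra G) (map u [1..<Suc k]) \<one>\<^bsub>G\<^esub> = (\<Sum>a\<in>T. \<Prod>i = 1..k. u i (a i))"
proof -
  have T: "T \<subseteq> {1..k} \<rightarrow>\<^sub>E carrier G" using M unfolding multiplicative_matching_def by blast
  have iv: "{1..<Suc k} = {1..k}" by auto
  have finF: "finite ({1..k} \<rightarrow>\<^sub>E carrier G)" using fin by (intro finite_PiE) auto
  have "list_product (group_algebra G) (map u [1..<Suc k]) \<one>\<^bsub>G\<^esub> =
      (\<Sum>f\<in>{1..k} \<rightarrow>\<^sub>E carrier G. if list_product G (map f [1..<Suc k]) = \<one>\<^bsub>G\<^esub>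
        then \<Prod>i = 1..k. u i (f i) else 0)"
    using list_product_group_algebra_apply[OF assms(1) fin, of 1 "Suc k" u "\<one>\<^bsub>G\<^esub>"] unfolding iv by simp
  also have "\<dots> = (\<Sum>a\<in>T. if list_product G (map a [1..<Suc k]) = \<one>\<^bsub>G\<^esub>
        then \<Prod>i = 1..k. u i (a i) else 0)"
  proof (intro sum.mono_neutral_right finF T ballI)
    fix f assume f: "f \<in> ({1..k} \<rightarrow>\<^sub>E carrier G) - T"
    show "(if list_product G (map f [1..<Suc k]) = \<one>\<^bsub>G\<^esub> then \<Prod>i = 1..k. u i (f i) else 0) = 0"
    proof (rule ccontr)
      assume nz: "\<not> ?thesis"
      then have one: "list_product G (map f [1..<Suc k]) = \<one>\<^bsub>G\<^esub>"
        and nz': "(\<Prod>i = 1..k. u i (f i)) \<noteq> 0"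
        by (auto split: if_splits)
      \<comment> \<open>No factor vanishes, so each \<open>f i\<close> lies where \<open>u i\<close>
        may be nonzero.\<close>
      have "\<forall>i\<in>{1..k}. \<exists>a\<in>T. f i = a i" using nz' supp by fastforce
      then obtain a where a: "\<And>i. i \<in> {1..k} \<Longrightarrow> a i \<in> T" "\<And>i. i \<in> {1..k} \<Longrightarrow> f i = a i i"
        by metis
      have "map (\<lambda>i. a i i) [1..<Suc k] = map f [1..<Suc k]" using a(2) by (intro map_cong) (auto simp del: upt_Suc)
      then have one': "list_product G (map (\<lambda>i. a i i) [1..<Suc k]) = \<one>\<^bsub>G\<^esub>"
        using one by (simp only:)
      have const: "a i = a 1" if "i \<in> {1..k}" for i
        using multiplicative_matching_product_oneD[OF M a(1) one' that, of 1] k by auto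
      have a1: "a 1 \<in> T" using a(1) k by simp
      have "f = a 1"
      proof (rule PiE_ext)
        show "f \<in> {1..k} \<rightarrow>\<^sub>E carrier G" "a 1 \<in> {1..k} \<rightarrow>\<^sub>E carrier G" using f T a1 by auto
        show "f i = a 1 i" if "i \<in> {1..k}" for i using that a(2) const by metis
      qed
      then show False using f a1 by simp
    qed
  qed
  also have "\<dots> = (\<Sum>a\<in>T. \<Prod>i = 1..k. u i (a i))"
    using multiplicative_matching_product[OF M] by (intro sum.cong) auto
  finally show ?thesis .
qed

section \<open>The bound on the size of a matching\<close>

theorem theorem3:
  fixes G :: "('a, 'm) monoid_scheme"
    and X :: "nat \<Rightarrow> ('a \<Rightarrow> 'f::field) set"
    and k :: nat
    and T :: "(nat \<Rightarrow> 'a) set"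
  assumes "group G" and "finite (carrier G)"
    and "k \<ge> 2"
    and "\<And>i. i \<in> {1..k} \<Longrightarrow> group_algebra_subspace G (X i)"
    and "\<And>u. (\<And>i. i \<in> {1..k} \<Longrightarrow> u i \<in> X i) \<Longrightarrow>
           list_product (group_algebra G) (map u [1..<Suc k]) = \<zero>\<^bsub>group_algebra G\<^esub>"
    and "multiplicative_matching G k T"
  shows "finite T \<and> card T \<le> (\<Sum>i = 1..k. codim G (X i))"
proof (rule conjI)
  interpret group G by fact
  let ?C = "carrier G"
  have T: "T \<subseteq> {1..k} \<rightarrow>\<^sub>E ?C" using assms(6) unfolding multiplicative_matching_def by blast
  moreover have "finite ({1..k} \<rightarrow>\<^sub>E ?C)" using assms(2) by (intro finite_PiE) auto
  ultimately show finT: "finite T" by (rule finite_subset)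
  let ?A = "\<lambda>i. (\<lambda>a. a i) ` T"
  let ?Z = "\<lambda>i. {u \<in> X i. \<forall>x\<in>?C - ?A i. u x = 0}"
  \<comment> \<open>The elements of \<open>X i\<close> supported on \<open>?A i\<close>, pulled back
    along \<open>a \<mapsto> a i\<close>. All \<open>k\<close> spaces then consist of functions on
    tuples and share the index set \<open>T\<close>.\<close>
  define Y where "Y = (\<lambda>i. (\<lambda>u a. u (a i)) ` ?Z i)"
  have subX: "fun_space.subspace (X i)" and X: "X i \<subseteq> carrier (group_algebra G)"
    if "i \<in> {1..k}" for i
    using assms(4)[OF that] unfolding group_algebra_subspace_def by auto
  have suppX: "u x = 0" if "i \<in> {1..k}" "u \<in> X i" "x \<notin> ?C" for i u x
    using X[OF that(1)] that(2,3) by (auto simp: group_algebra_def)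
  have subY: "fun_space.subspace (Y i)" if "i \<in> {1..k}" for i
  proof -
    have Z: "fun_space.subspace (?Z i)" by (rule subspace_vanishing_on[OF subX[OF that]])
    interpret eval: module_hom fun_scale fun_scale "\<lambda>(u :: 'a \<Rightarrow> 'f) (a :: nat \<Rightarrow> 'a). u (a i)"
      by unfold_locales (auto simp: fun_scale_def fun_eq_iff)
    show ?thesis unfolding Y_def by (rule eval.subspace_image[OF Z])
  qed
  \<comment> \<open>Codimension does not grow on passing to \<open>?A i\<close>: from at least
    \<open>dim (X i)\<close> interpolation points, vanishing off \<open>?A i\<close> costs at most
    \<open>order G - card T\<close>.\<close>
  have "\<exists>P \<subseteq> T. card T \<le> card P + codim G (X i) \<and> interpolates (Y i) P" if i: "i \<in> {1..k}" for i
  proof -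
    have inj: "inj_on (\<lambda>a. a i) T" by (rule multiplicative_matching_inj_on[OF assms(6,3) i])
    have AC: "?A i \<subseteq> ?C" using T i by (auto dest!: subsetD dest: PiE_mem)
    obtain P where P: "P \<subseteq> ?C" "fun_space.dim (X i) \<le> card P" "interpolates (X i) P"
      using interpolates_dim[OF subX[OF i] assms(2)] suppX[OF i] by blast
    have "finite P" using P(1) assms(2) finite_subset by blast
    from interpolates_vanishing_on[OF _ subX[OF i] P(3) this, of "?C - ?A i"] assms(2)
    obtain Q where Q: "Q \<subseteq> P - (?C - ?A i)" "card P \<le> card Q + card (?C - ?A i)"
        "interpolates (?Z i) Q"
      by auto
    \<comment> \<open>\<open>Q\<close> lies in \<open>?A i\<close>, so \<open>R\<close> is its
      preimage among the tuples, of the same size by injectivity.\<close>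
    define R where "R = {a \<in> T. a i \<in> Q}"
    have QR: "Q = (\<lambda>a. a i) ` R" using Q(1) P(1) unfolding R_def by auto
    have "inj_on (\<lambda>a. a i) R" using inj by (rule inj_on_subset) (auto simp: R_def)
    then have cQ: "card Q = card R" unfolding QR by (rule card_image)
    have "card (?C - ?A i) = order G - card T"
      using AC finT card_image[OF inj] by (simp add: card_Diff_subset order_def)
    \<comment> \<open>This keeps the natural-number subtraction \<open>order G - card T\<close> from
      truncating.\<close>
    moreover have "card T \<le> order G"
      using card_mono[OF assms(2) AC] card_image[OF inj] by (simp add: order_def)
    ultimately have "card T \<le> card R + codim G (X i)"
      using Q(2) P(2) cQ unfolding codim_def by linarith
    moreover have "interpolates (Y i) R"
      unfolding interpolates_def
    proof
      fix g :: "(nat \<Rightarrow> 'a) \<Rightarrow> 'f"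
      \<comment> \<open>The values prescribed on tuples are carried to points of \<open>Q\<close> by
        the inverse of the injective map \<open>a \<mapsto> a i\<close>.\<close>
      obtain u where u: "u \<in> ?Z i" "\<forall>x\<in>Q. u x = g (the_inv_into T (\<lambda>a. a i) x)"
        by (rule interpolatesE[OF Q(3)])
      have "\<forall>a\<in>R. u (a i) = g a"
        using u(2) the_inv_into_f_f[OF inj] unfolding R_def by simp
      moreover have "(\<lambda>a. u (a i)) \<in> Y i" unfolding Y_def using u(1) by (rule imageI)
      ultimately show "\<exists>y\<in>Y i. \<forall>a\<in>R. y a = g a" by (rule rev_bexI[rotated])
    qed
    moreover have "R \<subseteq> T" unfolding R_def by blast
    ultimately show ?thesis by blast
  qed
  then obtain P where P: "\<And>i. i \<in> {1..k} \<Longrightarrow>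
      P i \<subseteq> T \<and> card T \<le> card (P i) + codim G (X i) \<and> interpolates (Y i) (P i)"
    by metis
  show "card T \<le> (\<Sum>i = 1..k. codim G (X i))"
  proof (rule ccontr)
    assume "\<not> ?thesis"
    then obtain y where y: "\<forall>i\<in>{1..k}. y i \<in> Y i" "(\<Sum>a\<in>T. \<Prod>i = 1..k. y i a) \<noteq> 0"
      using diagonal_form_nonzero[where Y = Y and P = P, OF finT assms(3) subY P] by (metis not_le)
    have "\<forall>i\<in>{1..k}. \<exists>u. u \<in> ?Z i \<and> y i = (\<lambda>a. u (a i))" using y(1) unfolding Y_def by blast
    from bchoice[OF this] obtain u where u: "\<And>i. i \<in> {1..k} \<Longrightarrow> u i \<in> ?Z i"
      "\<And>i. i \<in> {1..k} \<Longrightarrow> y i = (\<lambda>a. u i (a i))"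
      by blast
    \<comment> \<open>The nonzero diagonal form is the coefficient at the identity of a product of
      elements of the \<open>X i\<close>, which vanishes by hypothesis.\<close>
    have "(\<Sum>a\<in>T. \<Prod>i = 1..k. u i (a i)) = list_product (group_algebra G) (map u [1..<Suc k]) \<one>\<^bsub>G\<^esub>"
    proof (rule coefficient_at_one_on_matching[symmetric, OF monoid_axioms assms(2) _ assms(6)])
      show "k \<ge> 1" using assms(3) by simp
      show "u i x = 0" if "i \<in> {1..k}" "x \<notin> ?A i" for i x
        using u(1)[OF that(1)] suppX[OF that(1)] that(2) by (cases "x \<in> ?C") auto
    qed
    also have "\<dots> = 0" using assms(5)[of u] u(1) by (simp add: group_algebra_def)
    finally have "(\<Sum>a\<in>T. \<Prod>i = 1..k. y i a) = 0" using u(2) by simp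
    with y(2) show False by blast
  qed
qed

end
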